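(* Let $(S,\cdot)$ be a left amenable semigroup, let $h$ be a homomorphism from $S$ onto a semigroup $(T,\cdot)$, and let $B\subseteq T$. Then $d^*(B)=d^*(h^{-1}[B])$.
   Context: A mean on a semigroup $S$ is a continuous linear functional $\mu$ on $l_\infty(S)$ (bounded real functions, sup norm) with $\|\mu\|=1$ and $\mu(g)\ge0$ whenever $g\ge0$; it is left invariant if $\mu(g\circ\lambda_s)=\mu(g)$ for all $s\in S$, $g\in l_\infty(S)$, where $\lambda_s(y)=sy$. $LIM(S)$ is the set of left invariant means; $S$ is left amenable if $LIM(S)\ne\emptyset$. The Banach density of $A\subseteq S$ is $d^*(A)=\sup\{\lambda(\chi_A):\lambda\in LIM(S)\}$ (the image $T$ of a left amenable semigroup under a surjective homomorphism is left amenable, so $d^*(B)$ is defined). *)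

theory Defs
  imports "HOL-Analysis.Analysis" "HOL-Probability.Discrete_Topology"
begin

text \<open>
  The space of all bounded real functions with the supremum norm. It is obtained
  as the space of bounded continuous functions on the discrete copy of the type,
  where continuity is no restriction.
\<close>

type_synonym 'a linf = "'a discrete \<Rightarrow>\<^sub>C real"

lemma apply_Bcontfun_discrete:
  fixes f :: "'a discrete \<Rightarrow> real"
  assumes "bounded (range f)"
  shows "apply_bcontfun (Bcontfun f) = f"
proof -
  have "f \<in> bcontfun"
    using assms by (simp add: bcontfun_def continuous_on_open_vimage open_discrete)
  then show ?thesis by (rule Bcontfun_inverse)
qed

definition left_translate :: "'s::semigroup_mult \<Rightarrow> 's linf \<Rightarrow> 's linf"
  where "left_translate s g =
    Bcontfun (\<lambda>y. apply_bcontfun g (discrete (s * of_discrete y)))"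

definition chi :: "'s set \<Rightarrow> 's linf"
  where "chi A = Bcontfun (\<lambda>y. indicator A (of_discrete y))"

text \<open>
  The functions under \<open>Bcontfun\<close> in the two definitions are bounded, so the
  elements defined are these functions.
\<close>

lemma apply_left_translate:
  "apply_bcontfun (left_translate s g) y = apply_bcontfun g (discrete (s * of_discrete y))"
proof -
  have "bounded (range (\<lambda>y. apply_bcontfun g (discrete (s * of_discrete y))))"
    by (rule bounded_subset[OF bounded_apply_bcontfun[of g]]) auto
  then show ?thesis
    unfolding left_translate_def by (simp add: apply_Bcontfun_discrete)
qed

lemma apply_chi: "apply_bcontfun (chi A) y = indicator A (of_discrete y)"
proof -
  have "bounded (range (\<lambda>y. indicator A (of_discrete y) :: real))"
    by (rule bounded_subset[of "{0, 1}"]) (auto simp: indicator_def)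
  then show ?thesis
    unfolding chi_def by (simp add: apply_Bcontfun_discrete)
qed

text \<open>
  Elements of the type \<open>'s linf \<Rightarrow>\<^sub>L real\<close> are the continuous linear functionals,
  and their norm is the operator norm.
\<close>

definition is_mean :: "('s linf \<Rightarrow>\<^sub>L real) \<Rightarrow> bool"
  where "is_mean \<mu> \<longleftrightarrow>
    norm \<mu> = 1 \<and> (\<forall>g. (\<forall>x. 0 \<le> apply_bcontfun g x) \<longrightarrow> 0 \<le> blinfun_apply \<mu> g)"

definition left_invariant_means :: "('s::semigroup_mult linf \<Rightarrow>\<^sub>L real) set"
  where "left_invariant_means = {\<mu>. is_mean \<mu> \<and>
    (\<forall>s g. blinfun_apply \<mu> (left_translate s g) = blinfun_apply \<mu> g)}"

definition left_amenable :: "'s::semigroup_mult itself \<Rightarrow> bool"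
  where "left_amenable _ \<longleftrightarrow> (left_invariant_means :: ('s linf \<Rightarrow>\<^sub>L real) set) \<noteq> {}"

text \<open>
  The supremum is taken in the reals: the set is bounded above by 1, and it is nonempty
  if the semigroup is left amenable. For a semigroup that is not left amenable the value
  is a meaningless default.
\<close>

definition banach_density :: "'s::semigroup_mult set \<Rightarrow> real"
  where "banach_density A = (SUP \<mu>\<in>left_invariant_means. blinfun_apply \<mu> (chi A))"

end

theory Submission
  imports Defs
begin

text \<open>
  A left invariant mean on \<open>S\<close> pushes forward along \<open>h\<close> to one on \<open>T\<close>. Conversely, let \<open>k\<close> be a
  section of \<open>h\<close>, \<open>\<mu>\<close> a left invariant mean on \<open>T\<close> and \<open>\<nu>\<close> one on \<open>S\<close>. The push-forward \<open>\<kappa>\<close> of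
  \<open>\<mu>\<close> along \<open>k\<close> is a mean on \<open>S\<close> that lifts \<open>\<mu>\<close>, and averaging its translates with \<open>\<nu>\<close>, that is
  \<open>g \<mapsto> \<nu> (s \<mapsto> \<kappa> (g \<circ> \<lambda>\<^sub>s))\<close>, makes it left invariant. It still lifts \<open>\<mu>\<close>: for
  \<open>g = f \<circ> h\<close> the averaged function is the constant \<open>\<mu> f\<close>. So both suprema are taken over the same
  set of values.
\<close>

text \<open>Positivity on \<open>norm g - g\<close> and \<open>norm g + g\<close> bounds
  \<open>\<bar>\<mu> g\<bar>\<close> by \<open>norm g\<close> times the value at the constant 1, so
  \<open>norm \<mu> = 1\<close> forces that value to have modulus 1. Positivity excludes -1, and
  homogeneity gives the other constants.\<close>

lemma mean_const:
  assumes "is_mean \<mu>"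
  shows "blinfun_apply \<mu> (const_bcontfun c) = c"
proof -
  have scale: "blinfun_apply \<mu> (const_bcontfun a) = a * blinfun_apply \<mu> (const_bcontfun 1)" for a
  proof -
    have "const_bcontfun a = a *\<^sub>R (const_bcontfun 1 :: 'a linf)"
      by (rule bcontfun_eqI) simp
    then show ?thesis by (simp add: blinfun.scaleR_right)
  qed
  have "norm (const_bcontfun 1 :: 'a linf) \<le> 1"
    by (rule norm_bound) simp
  then have "\<bar>blinfun_apply \<mu> (const_bcontfun 1)\<bar> \<le> 1"
    using norm_blinfun[of \<mu> "const_bcontfun 1"] assms by (simp add: is_mean_def)
  moreover have "norm \<mu> \<le> \<bar>blinfun_apply \<mu> (const_bcontfun 1)\<bar>"
  proof (rule norm_blinfun_bound)
    fix g :: "'a linf"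
    have bound: "\<bar>apply_bcontfun g x\<bar> \<le> norm g" for x
      using norm_bounded[of g x] by simp
    have pos: "0 \<le> norm g - apply_bcontfun g x" "0 \<le> norm g + apply_bcontfun g x" for x
      using bound[of x] by linarith+
    have "0 \<le> blinfun_apply \<mu> (const_bcontfun (norm g) - g)"
         "0 \<le> blinfun_apply \<mu> (const_bcontfun (norm g) + g)"
      using assms pos by (auto simp: is_mean_def)
    then have "\<bar>blinfun_apply \<mu> g\<bar> \<le> blinfun_apply \<mu> (const_bcontfun (norm g))"
      by (simp add: blinfun.diff_right blinfun.add_right)
    also have "\<dots> \<le> \<bar>blinfun_apply \<mu> (const_bcontfun 1)\<bar> * norm g"
      by (subst scale) (simp add: mult.commute mult_left_mono)
    finally show "norm (blinfun_apply \<mu> g) \<le> \<bar>blinfun_apply \<mu> (const_bcontfun 1)\<bar> * norm g"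
      by simp
  qed simp
  moreover have "0 \<le> blinfun_apply \<mu> (const_bcontfun 1)"
    using assms by (simp add: is_mean_def)
  ultimately have "blinfun_apply \<mu> (const_bcontfun 1) = 1"
    using assms by (simp add: is_mean_def)
  then show ?thesis using scale[of c] by simp
qed

text \<open>Applying \<open>F\<close> to \<open>norm g - g\<close> and \<open>norm g + g\<close>
  shows \<open>\<bar>F g\<bar> \<le> norm g\<close>, so continuity comes for free. Means can thus be
  built by checking algebraic conditions only.\<close>

lemma positive_unital_linear_mean:
  fixes F :: "'a linf \<Rightarrow> real"
  assumes F: "linear F"
    and pos: "\<And>g. (\<And>x. 0 \<le> apply_bcontfun g x) \<Longrightarrow> 0 \<le> F g"
    and unit: "F (const_bcontfun 1) = 1"
  obtains \<mu> where "is_mean \<mu>" "blinfun_apply \<mu> = F"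
proof -
  have bound: "\<bar>F g\<bar> \<le> norm g" for g
  proof -
    have le: "0 \<le> norm g - apply_bcontfun g x" "0 \<le> norm g + apply_bcontfun g x" for x
      using norm_bounded[of g x] by (simp_all add: abs_le_iff)
    have "0 \<le> F (norm g *\<^sub>R const_bcontfun 1 - g)"
      by (rule pos) (use le in simp)
    moreover have "0 \<le> F (norm g *\<^sub>R const_bcontfun 1 + g)"
      by (rule pos) (use le in simp)
    ultimately show ?thesis
      using F unit by (simp add: linear_diff linear_add linear_cmul)
  qed
  then have bl: "bounded_linear F"
    using F by (intro bounded_linear_intro[where K = 1]) (auto simp: linear_add linear_cmul)
  have app: "blinfun_apply (Blinfun F) = F"
    using bl by (rule bounded_linear_Blinfun_apply)
  have "norm (Blinfun F) \<le> 1"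
    by (rule norm_blinfun_bound) (use bound app in auto)
  \<comment> \<open>The constant 1 is the test vector for the reverse bound: its norm is at most 1
    and its image is 1.\<close>
  moreover have "norm (const_bcontfun 1 :: 'a linf) \<le> 1"
    by (rule norm_bound) simp
  then have "1 \<le> norm (Blinfun F)"
    using norm_blinfun[of "Blinfun F" "const_bcontfun 1"] unit
    by (simp add: app) (meson mult_left_le norm_ge_zero order_trans)
  ultimately have "is_mean (Blinfun F)"
    using pos by (simp add: is_mean_def app)
  then show ?thesis using app that by blast
qed

definition pullback :: "('a \<Rightarrow> 'b) \<Rightarrow> 'b linf \<Rightarrow> 'a linf"
  where "pullback \<phi> g = Bcontfun (\<lambda>x. apply_bcontfun g (discrete (\<phi> (of_discrete x))))"

lemma apply_pullback [simp]:
  "apply_bcontfun (pullback \<phi> g) x = apply_bcontfun g (discrete (\<phi> (of_discrete x)))"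
proof -
  have "bounded (range (\<lambda>x. apply_bcontfun g (discrete (\<phi> (of_discrete x)))))"
    by (rule bounded_subset[OF bounded_apply_bcontfun[of g]]) auto
  then show ?thesis
    unfolding pullback_def by (simp add: apply_Bcontfun_discrete)
qed

lemma pullback_chi: "pullback \<phi> (chi B) = chi (\<phi> -` B)"
  by (rule bcontfun_eqI) (simp add: apply_chi discrete_inverse indicator_def)

text \<open>For a homomorphism, applying \<open>h\<close> after translation by \<open>s\<close> is
  the same as translating by \<open>h s\<close> after applying \<open>h\<close>.\<close>

lemma left_translate_pullback:
  assumes "\<And>x y. h (x * y) = h x * h y"
  shows "left_translate s (pullback h g) = pullback h (left_translate (h s) g)"
  by (rule bcontfun_eqI) (simp add: apply_left_translate discrete_inverse assms)

text \<open>The map \<open>\<phi>\<close> is arbitrary because this is applied both to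
  \<open>h\<close> and to the section \<open>inv h\<close>, which in general is no
  homomorphism.\<close>

lemma mean_pushforward:
  assumes "is_mean \<mu>"
  obtains \<nu> where "is_mean \<nu>" "\<And>g. blinfun_apply \<nu> g = blinfun_apply \<mu> (pullback \<phi> g)"
proof (rule positive_unital_linear_mean[of "\<lambda>g. blinfun_apply \<mu> (pullback \<phi> g)"])
  have "pullback \<phi> (f + g) = pullback \<phi> f + pullback \<phi> g"
    "pullback \<phi> (c *\<^sub>R f) = c *\<^sub>R pullback \<phi> f" for f g c
    by (auto intro!: bcontfun_eqI)
  then show "linear (\<lambda>g. blinfun_apply \<mu> (pullback \<phi> g))"
    by (intro linearI) (simp_all add: blinfun.add_right blinfun.scaleR_right)
  show "0 \<le> blinfun_apply \<mu> (pullback \<phi> g)" if "\<And>x. 0 \<le> apply_bcontfun g x" for g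
    using assms that by (simp add: is_mean_def)
  have "pullback \<phi> (const_bcontfun 1) = const_bcontfun 1"
    by (rule bcontfun_eqI) simp
  then show "blinfun_apply \<mu> (pullback \<phi> (const_bcontfun 1)) = 1"
    using mean_const[OF assms] by simp
qed (use that in auto)

text \<open>Followed by \<open>\<nu>\<close>, this operator gives the Arens product of
  \<open>\<nu>\<close> and \<open>\<kappa>\<close>, also known as the convolution of the two
  means.\<close>

definition orbit_function :: "('s::semigroup_mult linf \<Rightarrow>\<^sub>L real) \<Rightarrow> 's linf \<Rightarrow> 's linf"
  where "orbit_function \<kappa> g = Bcontfun (\<lambda>s. blinfun_apply \<kappa> (left_translate (of_discrete s) g))"

lemma apply_orbit_function:
  "apply_bcontfun (orbit_function \<kappa> g) s = blinfun_apply \<kappa> (left_translate (of_discrete s) g)"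
proof -
  have "norm (blinfun_apply \<kappa> (left_translate t g)) \<le> norm \<kappa> * norm g" for t
  proof -
    \<comment> \<open>Every value of a translate of \<open>g\<close> is a value of
      \<open>g\<close>.\<close>
    have "norm (left_translate t g) \<le> norm g"
      by (rule norm_bound) (simp add: apply_left_translate norm_bounded del: real_norm_def)
    then show ?thesis
      using norm_blinfun[of \<kappa> "left_translate t g"] by (meson mult_left_mono norm_ge_zero order_trans)
  qed
  then have "bounded (range (\<lambda>s. blinfun_apply \<kappa> (left_translate (of_discrete s) g)))"
    by (auto simp: bounded_iff)
  then show ?thesis
    unfolding orbit_function_def by (simp add: apply_Bcontfun_discrete)
qed

text \<open>\<open>\<rho>\<close> inherits invariance from \<open>\<nu>\<close>, because
  \<open>orbit_function \<kappa>\<close> commutes with left translations.\<close>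

lemma averaged_mean:
  assumes \<kappa>: "is_mean \<kappa>" and \<nu>: "\<nu> \<in> left_invariant_means"
  obtains \<rho> where "\<rho> \<in> left_invariant_means"
    "\<And>g. blinfun_apply \<rho> g = blinfun_apply \<nu> (orbit_function \<kappa> g)"
proof -
  have \<nu>_mean: "is_mean \<nu>"
    and \<nu>_inv: "\<And>s g. blinfun_apply \<nu> (left_translate s g) = blinfun_apply \<nu> g"
    using \<nu> by (auto simp: left_invariant_means_def)
  obtain \<rho> where \<rho>: "is_mean \<rho>" "blinfun_apply \<rho> = (\<lambda>g. blinfun_apply \<nu> (orbit_function \<kappa> g))"
  proof (rule positive_unital_linear_mean[of "\<lambda>g. blinfun_apply \<nu> (orbit_function \<kappa> g)"])
    have "left_translate s (f + g) = left_translate s f + left_translate s g"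
      "left_translate s (c *\<^sub>R f) = c *\<^sub>R left_translate s f" for s :: 'a and f g c
      by (auto intro!: bcontfun_eqI simp: apply_left_translate)
    then have "orbit_function \<kappa> (f + g) = orbit_function \<kappa> f + orbit_function \<kappa> g"
      "orbit_function \<kappa> (c *\<^sub>R f) = c *\<^sub>R orbit_function \<kappa> f" for f g c
      by (auto intro!: bcontfun_eqI simp: apply_orbit_function blinfun.add_right blinfun.scaleR_right)
    then show "linear (\<lambda>g. blinfun_apply \<nu> (orbit_function \<kappa> g))"
      by (intro linearI) (simp_all add: blinfun.add_right blinfun.scaleR_right)
    show "0 \<le> blinfun_apply \<nu> (orbit_function \<kappa> g)" if "\<And>x. 0 \<le> apply_bcontfun g x" for g
      using \<kappa> \<nu>_mean that by (simp add: is_mean_def apply_orbit_function apply_left_translate)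
    have "left_translate s (const_bcontfun 1) = const_bcontfun 1" for s :: 'a
      by (rule bcontfun_eqI) (simp add: apply_left_translate)
    then have "orbit_function \<kappa> (const_bcontfun 1) = const_bcontfun 1"
      by (intro bcontfun_eqI) (simp add: apply_orbit_function mean_const[OF \<kappa>])
    then show "blinfun_apply \<nu> (orbit_function \<kappa> (const_bcontfun 1)) = 1"
      by (simp add: mean_const[OF \<nu>_mean])
  qed
  \<comment> \<open>The order of the factors is reversed. This is what makes the orbit function of
    \<open>left_translate t g\<close> at \<open>s\<close> equal to that of \<open>g\<close> at
    \<open>t * s\<close>.\<close>
  have "left_translate s (left_translate t g) = left_translate (t * s) g" for s t :: 'a and g
    by (rule bcontfun_eqI) (simp add: apply_left_translate discrete_inverse mult.assoc)
  then have "orbit_function \<kappa> (left_translate t g) = left_translate t (orbit_function \<kappa> g)" for t g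
    by (intro bcontfun_eqI) (simp add: apply_orbit_function apply_left_translate discrete_inverse)
  then have "\<rho> \<in> left_invariant_means"
    using \<rho> \<nu>_inv by (simp add: left_invariant_means_def)
  then show ?thesis using \<rho>(2) that by simp
qed

lemma left_invariant_mean_pushforward:
  fixes h :: "'s::semigroup_mult \<Rightarrow> 't::semigroup_mult"
  assumes hom: "\<And>x y. h (x * y) = h x * h y" and "surj h"
    and \<nu>: "\<nu> \<in> left_invariant_means"
  obtains \<mu> where "\<mu> \<in> left_invariant_means"
    "\<And>g. blinfun_apply \<mu> g = blinfun_apply \<nu> (pullback h g)"
proof -
  obtain \<mu> where \<mu>: "is_mean \<mu>" "\<And>g. blinfun_apply \<mu> g = blinfun_apply \<nu> (pullback h g)"
    using \<nu> mean_pushforward[of \<nu> h] by (auto simp: left_invariant_means_def)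
  have "blinfun_apply \<mu> (left_translate t g) = blinfun_apply \<mu> g" for t g
  proof -
    \<comment> \<open>Surjectivity turns every translation on the image into one that
      \<open>\<nu>\<close> is known to respect.\<close>
    obtain s where "t = h s" using \<open>surj h\<close> by blast
    then have "pullback h (left_translate t g) = left_translate s (pullback h g)"
      by (simp add: left_translate_pullback hom)
    then show ?thesis
      using \<nu> by (simp add: \<mu> left_invariant_means_def)
  qed
  then show ?thesis
    using \<mu> that by (simp add: left_invariant_means_def)
qed

lemma left_invariant_mean_lift:
  fixes h :: "'s::semigroup_mult \<Rightarrow> 't::semigroup_mult"
  assumes amen: "left_amenable TYPE('s)"
    and hom: "\<And>x y. h (x * y) = h x * h y" and "surj h"
    and \<mu>: "\<mu> \<in> left_invariant_means"
  obtains \<rho> where "\<rho> \<in> left_invariant_means"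
    "\<And>g. blinfun_apply \<rho> (pullback h g) = blinfun_apply \<mu> g"
proof -
  obtain \<nu> :: "'s linf \<Rightarrow>\<^sub>L real" where \<nu>: "\<nu> \<in> left_invariant_means"
    using amen by (auto simp: left_amenable_def)
  obtain \<kappa> where \<kappa>: "is_mean \<kappa>" "\<And>g. blinfun_apply \<kappa> g = blinfun_apply \<mu> (pullback (inv h) g)"
    using \<mu> mean_pushforward[of \<mu> "inv h"] by (auto simp: left_invariant_means_def)
  obtain \<rho> where \<rho>: "\<rho> \<in> left_invariant_means"
    "\<And>g. blinfun_apply \<rho> g = blinfun_apply \<nu> (orbit_function \<kappa> g)"
    using averaged_mean[OF \<kappa>(1) \<nu>] by blast
  \<comment> \<open>Hence \<open>\<kappa>\<close> agrees with \<open>\<mu>\<close> on functions that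
    factor through \<open>h\<close>.\<close>
  have "pullback (inv h) (pullback h g) = g" for g
    by (rule bcontfun_eqI)
      (simp add: discrete_inverse of_discrete_inverse surj_f_inv_f[OF \<open>surj h\<close>])
  \<comment> \<open>The value at \<open>s\<close> is \<open>\<mu>\<close> of the translate of
    \<open>g\<close> by \<open>h s\<close>, and invariance of \<open>\<mu>\<close> removes the
    dependence on \<open>s\<close>. Any mean \<open>\<nu>\<close> then returns this
    constant.\<close>
  then have "orbit_function \<kappa> (pullback h g) = const_bcontfun (blinfun_apply \<mu> g)" for g
    using \<mu> by (intro bcontfun_eqI)
      (simp add: apply_orbit_function left_translate_pullback hom \<kappa> left_invariant_means_def)
  then have "blinfun_apply \<rho> (pullback h g) = blinfun_apply \<mu> g" for g
    using \<nu> by (simp add: \<rho> mean_const left_invariant_means_def)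
  then show ?thesis using \<rho>(1) that by blast
qed

theorem theorem3p4:
  fixes h :: "'s::semigroup_mult \<Rightarrow> 't::semigroup_mult" and B :: "'t set"
  assumes "left_amenable TYPE('s)"
    and "\<And>x y. h (x * y) = h x * h y"
    and "surj h"
  shows "banach_density B = banach_density (h -` B)"
proof -
  have "(\<lambda>\<mu>. blinfun_apply \<mu> (chi B)) ` left_invariant_means =
    (\<lambda>\<nu>. blinfun_apply \<nu> (chi (h -` B))) ` left_invariant_means"
  proof (intro subset_antisym image_subsetI)
    fix \<mu> :: "'t linf \<Rightarrow>\<^sub>L real" assume "\<mu> \<in> left_invariant_means"
    then obtain \<rho> where "\<rho> \<in> left_invariant_means"
      "\<And>g. blinfun_apply \<rho> (pullback h g) = blinfun_apply \<mu> g"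
      using left_invariant_mean_lift[OF assms] by blast
    \<comment> \<open>The indicator of the preimage of \<open>B\<close> is
      \<open>pullback h (chi B)\<close>, so \<open>\<rho>\<close> takes on it the value of
      \<open>\<mu>\<close> at \<open>chi B\<close>.\<close>
    then show "blinfun_apply \<mu> (chi B) \<in>
      (\<lambda>\<nu>. blinfun_apply \<nu> (chi (h -` B))) ` left_invariant_means"
      by (metis image_eqI pullback_chi)
  next
    fix \<nu> :: "'s linf \<Rightarrow>\<^sub>L real" assume "\<nu> \<in> left_invariant_means"
    then obtain \<mu> where "\<mu> \<in> left_invariant_means"
      "\<And>g. blinfun_apply \<mu> g = blinfun_apply \<nu> (pullback h g)"
      using left_invariant_mean_pushforward[OF assms(2,3)] by blast
    then show "blinfun_apply \<nu> (chi (h -` B)) \<in>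
      (\<lambda>\<mu>. blinfun_apply \<mu> (chi B)) ` left_invariant_means"
      by (metis image_eqI pullback_chi)
  qed
  then show ?thesis by (simp add: banach_density_def)
qed

end
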